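(* Let $w\in W$ have order $l$ and let $r:R\to\mathbb Q_{\ge0}$. The stratum $\mathfrak t_w(\mathcal O)_r$ is non-empty if and only if the following four conditions hold: (1) $r$ takes values in $\frac1l\mathbb Z$. (2) $R_m$ is $\mathbb Q$-closed for all $m\ge0$. (3) $wr=r$. (4) $(\mathfrak a_{j+1}/\mathfrak a_j)(w,j)\cap(\mathfrak a_{j+1}/\mathfrak a_j)^\sharp$ is non-empty for all $j\ge0$.
   Context: Let $k$ be an algebraically closed field, $G$ a connected reductive group over $k$, $T\subset G$ a maximal torus, $\mathfrak t$ its Lie algebra, $R\subset X^*(T)$ the set of roots, $W$ the Weyl group of $T$ in $G$. Assume $|W|$ is invertible in $k$. The differential of a root $\alpha$ is also denoted $\alpha\in\mathfrak t^*$; for a $k$-algebra $A$ put $\mathfrak t(A)=\mathfrak t\otimes_kA$ and extend $\alpha$ to an $A$-linear map $\mathfrak t(A)\to A$. $W$ acts on functions $r$ on $R$ by $(xr)(\alpha)=r(x^{-1}\alpha)$. $\mathcal O=k[[\epsilon]]$, $F=k((\epsilon))$; fix an algebraic closure $\bar F$ with valuation $\mathrm{val}$, $\mathrm{val}(\epsilon)=1$. For positive integers $l$ invertible in $k$ choose compatibly $\epsilon^{1/l}\in\bar F$ (with $(\epsilon^{1/lm})^m=\epsilon^{1/l}$) and primitive $l$-th roots of unity $\zeta_l\in k$ (with $(\zeta_{lm})^m=\zeta_l$). For $w\in W$ of order $l$ put $E=k((\epsilon_E))$, $\epsilon_E=\epsilon^{1/l}$, $\mathcal O_E=k[[\epsilon_E]]$,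 and let $\tau_E$ be the automorphism of $E/F$ with $\tau_E(\epsilon_E)=\zeta_l\epsilon_E$. Define $\mathfrak t_w(\mathcal O)=\{u\in\mathfrak t(\mathcal O_E): w\tau_E(u)=u\}$ and, for $r:R\to\mathbb Q_{\ge0}$, $\mathfrak t_w(\mathcal O)_r=\{u\in\mathfrak t_w(\mathcal O):\mathrm{val}\,\alpha(u)=r(\alpha)\ \forall\alpha\in R\}$. For integers $m\ge0$ put $R_m=\{\alpha\in R:r(\alpha)\ge m/l\}$ and $\mathfrak a_m=\{u\in\mathfrak t:\alpha(u)=0\ \forall\alpha\in R_m\}$. A subset $R'\subset R$ is $\mathbb Q$-closed if every $\alpha\in R$ that is a $\mathbb Q$-linear combination of elements of $R'$ lies in $R'$. When $wr=r$, $w$ preserves all $R_m$ and $\mathfrak a_m$ and acts on $\mathfrak a_{j+1}/\mathfrak a_j$; put $(\mathfrak a_{j+1}/\mathfrak a_j)(w,j)=\{v\in\mathfrak a_{j+1}/\mathfrak a_j:wv=\zeta_l^{-j}v\}$. Since roots in $R_j$ vanish on $\mathfrak a_j$, they induce functionals on $\mathfrak a_{j+1}/\mathfrak a_j$; put $(\mathfrak a_{j+1}/\mathfrak a_j)^\sharp=\{u\in\mathfrak a_{j+1}/\mathfrak a_j:\alpha(u)\ne0\ \forall\alpha\in R_j\setminus R_{j+1}\}$. *)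

theory Defs
  imports
    "HOL-Algebra.Algebra"
    "HOL-Computational_Algebra.Computational_Algebra"
    "HOL-Library.Extended"
begin

section \<open>Root data\<close>

text \<open>
  A connected reductive group with a maximal torus \<open>(G, T)\<close> over an algebraically closed field is
  given by its reduced root datum \<open>(X, R, Y, R\<^sup>\<or>)\<close> with \<open>X = X\<^sup>*(T)\<close> and \<open>Y = X\<^sub>*(T)\<close>: every such
  pair has one, every reduced root datum comes from such a pair, and \<open>W\<close>, \<open>\<tt>\<close>, the action of \<open>W\<close>
  on \<open>\<tt>\<close> and the differentials of the roots are read off from it.  The groups \<open>X\<close> and \<open>Y\<close> are
  types of class \<^class>\<open>ab_group_add\<close> (which allows every rank, including \<open>0\<close>).
\<close>

definition zscale :: "int \<Rightarrow> 'a::ab_group_add \<Rightarrow> 'a" where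
  "zscale n x = (\<Sum>i<nat n. x) - (\<Sum>i<nat (- n). x)"

lemma zscale_of_nat: "zscale (int n) x = (\<Sum>i<n. x)"
  by (simp add: zscale_def)

lemma zscale_zero: "zscale 0 x = 0"
  by (simp add: zscale_def)

lemma zscale_succ: "zscale (n + 1) x = zscale n x + x"
proof (cases "n \<ge> 0")
  case True
  then have "nat (n + 1) = Suc (nat n)" "nat (- n) = 0" "nat (- (n + 1)) = 0" by auto
  then show ?thesis unfolding zscale_def by simp
next
  case False
  then have "nat (- n) = Suc (nat (- (n + 1)))" "nat (n + 1) = 0" "nat n = 0" by auto
  then show ?thesis unfolding zscale_def by simp
qed

lemma zscale_pred: "zscale (n - 1) x = zscale n x - x"
  using zscale_succ[of "n - 1" x] by simp

lemma zscale_add: "zscale (m + n) x = zscale m x + zscale n x"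
proof (induction n rule: int_induct[where k = 0])
  case base
  then show ?case by (simp add: zscale_zero)
next
  case (step1 i)
  then show ?case using zscale_succ[of "m + i" x] zscale_succ[of i x] by (simp add: algebra_simps)
next
  case (step2 i)
  have "zscale (m + (i - 1)) x = zscale (m + i) x - x"
    using zscale_pred[of "m + i" x] by (simp add: add_diff_eq)
  also have "\<dots> = zscale m x + (zscale i x - x)"
    by (simp add: step2.IH add_diff_eq)
  finally show ?case by (simp add: zscale_pred)
qed

lemma module_zscale: "Modules.module (zscale :: int \<Rightarrow> 'a::ab_group_add \<Rightarrow> 'a)"
proof
  fix m n :: int and x y :: 'a
  show "zscale n (x + y) = zscale n x + zscale n y"
    by (simp add: zscale_def sum.distrib)
  show "zscale (m + n) x = zscale m x + zscale n x"
    by (rule zscale_add)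
  show "zscale 1 x = x"
    by (simp add: zscale_def)
  show "zscale m (zscale n x) = zscale (m * n) x"
  proof (induction m rule: int_induct[where k = 0])
    case base
    then show ?case by (simp add: zscale_zero)
  next
    case (step1 i)
    then show ?case by (simp add: zscale_succ zscale_add[of _ n] distrib_right)
  next
    case (step2 i)
    then show ?case
      using zscale_add[of "(i - 1) * n" n x] by (simp add: zscale_pred algebra_simps)
  qed
qed

definition free_of_finite_rank :: "'a::ab_group_add itself \<Rightarrow> bool" where
  "free_of_finite_rank _ \<longleftrightarrow>
     (\<exists>B :: 'a set. finite B \<and> \<not> Modules.module.dependent zscale B \<and> Modules.module.span zscale B = UNIV)"

definition reflection ::
  "('x::ab_group_add \<Rightarrow> 'y \<Rightarrow> int) \<Rightarrow> ('x \<Rightarrow> 'y) \<Rightarrow> 'x \<Rightarrow> 'x \<Rightarrow> 'x" where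
  "reflection pair coroot \<alpha> \<chi> = \<chi> - zscale (pair \<chi> (coroot \<alpha>)) \<alpha>"

definition coreflection ::
  "('x \<Rightarrow> 'y::ab_group_add \<Rightarrow> int) \<Rightarrow> ('x \<Rightarrow> 'y) \<Rightarrow> 'x \<Rightarrow> 'y \<Rightarrow> 'y" where
  "coreflection pair coroot \<alpha> y = y - zscale (pair \<alpha> y) (coroot \<alpha>)"

text \<open>
  The two perfectness axioms say that the pairing identifies \<open>X\<close> with \<open>Hom(Y, \<int>)\<close> and \<open>Y\<close> with
  \<open>Hom(X, \<int>)\<close>; in particular they make it additive in both arguments.
\<close>

locale root_datum =
  fixes pair :: "'x::ab_group_add \<Rightarrow> 'y::ab_group_add \<Rightarrow> int"
    and R :: "'x set"
    and coroot :: "'x \<Rightarrow> 'y"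
  assumes free_X: "free_of_finite_rank TYPE('x)"
    and free_Y: "free_of_finite_rank TYPE('y)"
    and perfect_X: "bij_betw (\<lambda>\<chi>. pair \<chi>) UNIV {f. additive f}"
    and perfect_Y: "bij_betw (\<lambda>y \<chi>. pair \<chi> y) UNIV {f. additive f}"
    and finite_R: "finite R"
    and inj_coroot: "inj_on coroot R"
    and pair_coroot: "\<alpha> \<in> R \<Longrightarrow> pair \<alpha> (coroot \<alpha>) = 2"
    and reflection_R: "\<alpha> \<in> R \<Longrightarrow> reflection pair coroot \<alpha> ` R = R"
    and coreflection_R: "\<alpha> \<in> R \<Longrightarrow> coreflection pair coroot \<alpha> ` (coroot ` R) = coroot ` R"
    and reduced: "\<lbrakk>\<alpha> \<in> R; \<beta> \<in> R; m \<noteq> 0; n \<noteq> 0; zscale m \<alpha> = zscale n \<beta>\<rbrakk> \<Longrightarrow> \<beta> = \<alpha> \<or> \<beta> = - \<alpha>"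

definition weyl_group ::
  "('x::ab_group_add \<Rightarrow> 'y \<Rightarrow> int) \<Rightarrow> 'x set \<Rightarrow> ('x \<Rightarrow> 'y) \<Rightarrow> ('x \<Rightarrow> 'x) set" where
  "weyl_group pair R coroot = generate (BijGroup UNIV) (reflection pair coroot ` R)"

text \<open>
  The action on functions on \<open>X\<close>, used both for \<open>(w r)(\<alpha>) = r (w\<^sup>-\<^sup>1 \<alpha>)\<close> and for the action of \<open>W\<close> on
  \<open>\<tt>(A) = Hom(X, A)\<close>, which is contragredient to the one on \<open>X\<close>.
\<close>

definition wact :: "('x \<Rightarrow> 'x) \<Rightarrow> ('x \<Rightarrow> 'a) \<Rightarrow> 'x \<Rightarrow> 'a" where
  "wact w f = (\<lambda>\<chi>. f (inv_into UNIV w \<chi>))"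

text \<open>A \<open>\<rat>\<close>-linear combination in \<open>X \<otimes> \<rat>\<close>, computed in \<open>Hom(Y, \<rat>) = X \<otimes> \<rat>\<close>.\<close>

definition rat_comb :: "('x \<Rightarrow> 'y \<Rightarrow> int) \<Rightarrow> 'x set \<Rightarrow> 'x \<Rightarrow> bool" where
  "rat_comb pair S \<alpha> \<longleftrightarrow>
     (\<exists>c :: 'x \<Rightarrow> rat. \<forall>y. of_int (pair \<alpha> y) = (\<Sum>\<beta>\<in>S. c \<beta> * of_int (pair \<beta> y)))"

definition Q_closed :: "('x \<Rightarrow> 'y \<Rightarrow> int) \<Rightarrow> 'x set \<Rightarrow> 'x set \<Rightarrow> bool" where
  "Q_closed pair R S \<longleftrightarrow> S \<subseteq> R \<and> (\<forall>\<alpha>\<in>R. rat_comb pair S \<alpha> \<longrightarrow> \<alpha> \<in> S)"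


section \<open>The Lie algebra of the torus\<close>

text \<open>
  Since \<open>T(A) = Hom(X, A\<^sup>\<times>)\<close>, the Lie algebra is \<open>\<tt>(A) = Hom(X, A) = X\<^sub>*(T) \<otimes> A\<close>, and the
  differential of a character is evaluation at it.
\<close>

definition lie_torus :: "('x::ab_group_add \<Rightarrow> 'a::ab_group_add) set" where
  "lie_torus = {u. additive u}"

definition differential :: "'x \<Rightarrow> ('x \<Rightarrow> 'a) \<Rightarrow> 'a" where
  "differential \<chi> u = u \<chi>"


section \<open>Roots of unity and the extension \<open>E\<close>\<close>

definition primitive_root_unity :: "nat \<Rightarrow> 'k::field \<Rightarrow> bool" where
  "primitive_root_unity l z \<longleftrightarrow> z ^ l = 1 \<and> (\<forall>m. 0 < m \<and> m < l \<longrightarrow> z ^ m \<noteq> 1)"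

definition compatible_roots_unity :: "(nat \<Rightarrow> 'k::field) \<Rightarrow> bool" where
  "compatible_roots_unity \<zeta> \<longleftrightarrow>
     (\<forall>l>0. of_nat l \<noteq> (0::'k) \<longrightarrow> primitive_root_unity l (\<zeta> l)) \<and>
     (\<forall>l>0. \<forall>m>0. of_nat (l * m) \<noteq> (0::'k) \<longrightarrow> \<zeta> (l * m) ^ m = \<zeta> l)"

text \<open>
  The ring \<open>\<O>\<^sub>E = k[[\<epsilon>\<^sub>E]]\<close> is \<^typ>\<open>'k fps\<close> with \<^term>\<open>fps_X\<close> in the role of \<open>\<epsilon>\<^sub>E = \<epsilon>\<^bsup>1/l\<^esup>\<close>, so that
  \<open>\<epsilon>\<close> is \<open>fps_X ^ l\<close>.  The valuation is normalised by \<open>val \<epsilon> = 1\<close>, so that \<open>\<epsilon>\<^sub>E\<close> has valuation \<open>1/l\<close>,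
  and \<open>\<tau>\<^sub>E\<close> is the substitution \<open>\<epsilon>\<^sub>E \<mapsto> \<zeta>\<^sub>l \<epsilon>\<^sub>E\<close>.
\<close>

definition val_E :: "nat \<Rightarrow> 'k::field fps \<Rightarrow> rat extended" where
  "val_E l f = (if f = 0 then Pinf else Fin (of_nat (subdegree f) / of_nat l))"

definition tau_E :: "'k::field \<Rightarrow> 'k fps \<Rightarrow> 'k fps" where
  "tau_E z f = fps_compose f (fps_const z * fps_X)"


section \<open>Strata\<close>

definition twisted_torus :: "('x::ab_group_add \<Rightarrow> 'x) \<Rightarrow> 'k::field \<Rightarrow> ('x \<Rightarrow> 'k fps) set" where
  "twisted_torus w z = {u \<in> lie_torus. wact w (tau_E z \<circ> u) = u}"

definition stratum ::
  "'x::ab_group_add set \<Rightarrow> nat \<Rightarrow> ('x \<Rightarrow> 'x) \<Rightarrow> 'k::field \<Rightarrow> ('x \<Rightarrow> rat) \<Rightarrow> ('x \<Rightarrow> 'k fps) set" where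
  "stratum R l w z r =
     {u \<in> twisted_torus w z. \<forall>\<alpha>\<in>R. val_E l (differential \<alpha> u) = Fin (r \<alpha>)}"

definition root_level :: "'x set \<Rightarrow> ('x \<Rightarrow> rat) \<Rightarrow> nat \<Rightarrow> nat \<Rightarrow> 'x set" where
  "root_level R r l m = {\<alpha> \<in> R. r \<alpha> \<ge> of_nat m / of_nat l}"

definition lie_level ::
  "'x::ab_group_add set \<Rightarrow> ('x \<Rightarrow> rat) \<Rightarrow> nat \<Rightarrow> nat \<Rightarrow> ('x \<Rightarrow> 'k::field) set" where
  "lie_level R r l m = {u \<in> lie_torus. \<forall>\<alpha>\<in>root_level R r l m. differential \<alpha> u = 0}"

text \<open>The elements of the quotient \<open>\<aa>\<^sub>j\<^sub>+\<^sub>1/\<aa>\<^sub>j\<close> are the cosets of \<open>\<aa>\<^sub>j\<close> in \<open>\<aa>\<^sub>j\<^sub>+\<^sub>1\<close>.\<close>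

definition lie_quot ::
  "'x::ab_group_add set \<Rightarrow> ('x \<Rightarrow> rat) \<Rightarrow> nat \<Rightarrow> nat \<Rightarrow> ('x \<Rightarrow> 'k::field) set set" where
  "lie_quot R r l j =
     lie_level R r l (Suc j) //
       {(u, v). u \<in> lie_level R r l (Suc j) \<and> v \<in> lie_level R r l (Suc j) \<and>
                (\<lambda>\<chi>. u \<chi> - v \<chi>) \<in> lie_level R r l j}"

text \<open>
  When \<open>w r = r\<close>, the induced action of \<open>w\<close> on cosets is the image; likewise multiplication by the
  nonzero scalar \<open>\<zeta>\<^sub>l\<^bsup>-j\<^esup>\<close>.
\<close>

definition lie_quot_eigen ::
  "'x::ab_group_add set \<Rightarrow> nat \<Rightarrow> ('x \<Rightarrow> 'x) \<Rightarrow> 'k::field \<Rightarrow> ('x \<Rightarrow> rat) \<Rightarrow> nat \<Rightarrow>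
     ('x \<Rightarrow> 'k) set set" where
  "lie_quot_eigen R l w z r j =
     {C \<in> lie_quot R r l j. wact w ` C = (\<lambda>u \<chi>. inverse z ^ j * u \<chi>) ` C}"

text \<open>
  A root in \<open>R\<^sub>j\<close> vanishes on \<open>\<aa>\<^sub>j\<close> and so takes a single value on a coset; this value is the induced
  functional.
\<close>

definition quot_differential :: "'x \<Rightarrow> ('x \<Rightarrow> 'k) set \<Rightarrow> 'k" where
  "quot_differential \<alpha> C = the_elem (differential \<alpha> ` C)"

definition lie_quot_sharp ::
  "'x::ab_group_add set \<Rightarrow> nat \<Rightarrow> ('x \<Rightarrow> rat) \<Rightarrow> nat \<Rightarrow> ('x \<Rightarrow> 'k::field) set set" where
  "lie_quot_sharp R l r j =
     {C \<in> lie_quot R r l j.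
        \<forall>\<alpha> \<in> root_level R r l j - root_level R r l (Suc j). quot_differential \<alpha> C \<noteq> 0}"

end

theory Submission
  imports Defs
begin

text \<open>
  Write \<open>u \<in> \<tt>(\<O>\<^sub>E)\<close> as \<open>\<Sum>\<^sub>j u\<^sub>j \<epsilon>\<^sub>E\<^sup>j\<close> with \<open>u\<^sub>j \<in> \<tt>\<close>.  Everything can be read off coefficientwise:
  \<open>w \<tau>\<^sub>E(u) = u\<close> says that \<open>w u\<^sub>j = \<zeta>\<^sub>l\<^bsup>-j\<^esup> u\<^sub>j\<close> for all \<open>j\<close>, and \<open>val \<alpha>(u) = n/l\<close> says that \<open>\<alpha>(u\<^sub>j) = 0\<close>
  for \<open>j < n\<close> and \<open>\<alpha>(u\<^sub>n) \<noteq> 0\<close>.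

  If \<open>u\<close> lies in the stratum, integrality and invariance of \<open>r\<close> are therefore immediate, and the
  class of \<open>u\<^sub>j\<close> modulo \<open>\<aa>\<^sub>j\<close> is a regular eigenvector in \<open>\<aa>\<^sub>j\<^sub>+\<^sub>1/\<aa>\<^sub>j\<close>.  The remaining point is that
  \<open>R\<^sub>m\<close>, the set of roots that vanish on \<open>u\<^sub>0, \<dots>, u\<^sub>m\<^sub>-\<^sub>1\<close>, is \<open>\<rat>\<close>-closed; in characteristic \<open>p\<close> this
  is not formal, because the denominators of a rational relation may be divisible by \<open>p\<close>.  Let \<open>W'\<close>
  be the group generated by the reflections in \<open>R\<^sub>m\<close>; it fixes each of these \<open>u\<^sub>i\<close>.  For \<open>\<beta> \<in> R\<^sub>m\<close> the
  sum \<open>\<Sum>g\<in>W'. g \<beta>\<close> is its own negative, so it vanishes, and hence \<open>\<Sum>g\<in>W'. g \<alpha> = 0\<close> for every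
  rational combination \<open>\<alpha>\<close> of \<open>R\<^sub>m\<close>.  Evaluating \<open>u\<^sub>i\<close> on this sum gives \<open>\<bar>W'\<bar> \<alpha>(u\<^sub>i) = 0\<close>, and \<open>\<bar>W'\<bar>\<close>
  divides \<open>\<bar>W\<bar>\<close>, which is invertible (\<open>rat_comb_vanishing\<close>).

  Conversely, lift the given class in \<open>\<aa>\<^sub>j\<^sub>+\<^sub>1/\<aa>\<^sub>j\<close> to some \<open>v \<in> \<aa>\<^sub>j\<^sub>+\<^sub>1\<close>.  The projection of \<open>v\<close> to the
  \<open>\<zeta>\<^sub>l\<^bsup>-j\<^esup>\<close>-eigenspace of \<open>w\<close> is defined, since \<open>l\<close> is invertible, and takes the same values as \<open>v\<close> on
  \<open>R\<^sub>j\<close> (\<open>eigen_lift\<close>).  The series with these projections as its coefficients lies in the stratum.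
\<close>

section \<open>Additive functions\<close>

lemma additive_zscale:
  assumes "additive f"
  shows "f (zscale n x) = zscale n (f x)"
  unfolding zscale_def
  by (simp add: additive.diff[OF assms] additive.sum[OF assms])

lemma zscale_eq_mult: "zscale n (x::'a::ring_1) = of_int n * x"
  by (cases "n \<ge> 0") (auto simp: zscale_def)

lemma additive_comp: "additive f \<Longrightarrow> additive g \<Longrightarrow> additive (f \<circ> g)"
  by (auto simp: additive_def)

lemma additive_inv:
  assumes "additive g" "bij g"
  shows "additive (inv' g)"
proof
  fix x y
  have "g (inv' g x + inv' g y) = x + y"
    using assms by (simp add: additive.add surj_f_inv_f bij_is_surj)
  then show "inv' g (x + y) = inv' g x + inv' g y"
    using assms(2) by (metis bij_inv_eq_iff)
qed


section \<open>The Weyl group\<close>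

lemma BijGroup_UNIV_simps:
  "carrier (BijGroup UNIV) = {f. bij f}"
  "\<one>\<^bsub>BijGroup UNIV\<^esub> = id"
  "bij g \<Longrightarrow> bij h \<Longrightarrow> g \<otimes>\<^bsub>BijGroup UNIV\<^esub> h = g \<circ> h"
  by (auto simp: BijGroup_def Bij_def fun_eq_iff compose_def)

lemma BijGroup_UNIV_pow:
  assumes "bij g"
  shows "g [^]\<^bsub>BijGroup UNIV\<^esub> (n::nat) = g ^^ n"
proof (induction n)
  case (Suc n)
  then show ?case
    using assms by (simp add: BijGroup_UNIV_simps bij_betw_funpow funpow_Suc_right del: funpow.simps)
qed (simp add: BijGroup_UNIV_simps)

context root_datum
begin

lemma additive_pair: "additive (\<lambda>\<chi>. pair \<chi> y)"
  using perfect_Y by (auto simp: bij_betw_def)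

lemma pair_ext: "(\<And>y. pair \<chi> y = pair \<chi>' y) \<Longrightarrow> \<chi> = \<chi>'"
  using perfect_X unfolding bij_betw_def by (auto intro!: injD[of pair])

lemma pair_zscale: "pair (zscale n \<chi>) y = n * pair \<chi> y"
  using additive_zscale[OF additive_pair, of n \<chi> y] by (simp add: zscale_eq_mult)

lemma zscale_eq_0_iff: "zscale n (\<chi>::'x) = 0 \<longleftrightarrow> n = 0 \<or> \<chi> = 0"
proof -
  have p0: "pair 0 y = 0" for y
    by (rule additive.zero[OF additive_pair])
  have "\<chi> = 0" if "zscale n \<chi> = 0" "n \<noteq> 0"
  proof (rule pair_ext)
    fix y
    show "pair \<chi> y = pair 0 y"
      using pair_zscale[of n \<chi> y] that p0 by simp
  qed
  moreover have "zscale n \<chi> = 0" if "n = 0 \<or> \<chi> = 0"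
    using that by (auto simp: zscale_def)
  ultimately show ?thesis
    by blast
qed

lemma additive_reflection: "additive (reflection pair coroot \<alpha>)"
proof
  fix x y
  show "reflection pair coroot \<alpha> (x + y) = reflection pair coroot \<alpha> x + reflection pair coroot \<alpha> y"
    by (simp add: reflection_def additive.add[OF additive_pair] zscale_add)
qed

lemma reflection_self:
  assumes "\<alpha> \<in> R"
  shows "reflection pair coroot \<alpha> \<alpha> = - \<alpha>"
  using pair_coroot[OF assms] zscale_add[of 1 1 \<alpha>]
  by (simp add: reflection_def zscale_def)

lemma reflection_involution:
  assumes "\<alpha> \<in> R"
  shows "reflection pair coroot \<alpha> (reflection pair coroot \<alpha> \<chi>) = \<chi>"
proof -
  let ?s = "reflection pair coroot \<alpha>" and ?n = "pair \<chi> (coroot \<alpha>)"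
  have \<chi>: "?s \<chi> = \<chi> - zscale ?n \<alpha>"
    by (rule reflection_def)
  have "?s (?s \<chi>) = ?s \<chi> - ?s (zscale ?n \<alpha>)"
    by (subst \<chi>) (rule additive.diff[OF additive_reflection])
  also have "\<dots> = ?s \<chi> - zscale ?n (?s \<alpha>)"
    by (simp add: additive_zscale[OF additive_reflection])
  also have "\<dots> = \<chi>"
    by (simp add: \<chi> reflection_self[OF assms]) (simp add: zscale_def sum_negf)
  finally show ?thesis .
qed

lemma bij_reflection: "\<alpha> \<in> R \<Longrightarrow> bij (reflection pair coroot \<alpha>)"
  by (rule o_bij[of "reflection pair coroot \<alpha>"]) (auto simp: reflection_involution)

lemma inverse_reflection:
  assumes "\<alpha> \<in> R"
  shows "inv\<^bsub>BijGroup UNIV\<^esub> (reflection pair coroot \<alpha>) = reflection pair coroot \<alpha>"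
proof (rule group.inv_equality[OF group_BijGroup])
  show "reflection pair coroot \<alpha> \<otimes>\<^bsub>BijGroup UNIV\<^esub> reflection pair coroot \<alpha> = \<one>\<^bsub>BijGroup UNIV\<^esub>"
    using assms by (auto simp: BijGroup_UNIV_simps bij_reflection reflection_involution)
qed (use assms in \<open>auto simp: BijGroup_UNIV_simps bij_reflection\<close>)

text \<open>
  Reflections are their own inverses, so an induction over the group that they generate needs no
  step for inverses.
\<close>

lemma weyl_group_induct [consumes 2, case_names id reflection comp]:
  assumes g: "g \<in> weyl_group pair S coroot" and S: "S \<subseteq> R"
    and id: "P id"
    and reflection: "\<And>\<alpha>. \<alpha> \<in> S \<Longrightarrow> P (reflection pair coroot \<alpha>)"
    and comp: "\<And>g h. bij g \<Longrightarrow> bij h \<Longrightarrow> P g \<Longrightarrow> P h \<Longrightarrow> P (g \<circ> h)"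
  shows "bij g \<and> P g"
  using g unfolding weyl_group_def
proof (induction rule: generate.induct)
  case one
  show ?case unfolding BijGroup_UNIV_simps using bij_id id by (rule conjI)
next
  case (incl h)
  then show ?case using reflection S bij_reflection by auto
next
  case (inv h)
  then obtain \<alpha> where "\<alpha> \<in> S" "h = reflection pair coroot \<alpha>" by auto
  moreover from this have "inv\<^bsub>BijGroup UNIV\<^esub> h = h"
    using inverse_reflection S by auto
  ultimately show ?case using reflection S bij_reflection by auto
next
  case (eng h1 h2)
  then show ?case using comp BijGroup_UNIV_simps(3)[of h1 h2] bij_comp[of h2 h1] by metis
qed

lemma weyl_group_root_automorphism:
  assumes "g \<in> weyl_group pair R coroot"
  shows "bij g" "additive g" "g ` R = R"
proof -
  have "bij g \<and> additive g \<and> g ` R = R"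
    using assms subset_refl
  proof (induction rule: weyl_group_induct)
    case id
    then show ?case by (simp add: additive_def)
  next
    case (reflection \<alpha>)
    then show ?case by (simp add: additive_reflection reflection_R)
  next
    case (comp g h)
    then show ?case using additive_comp[of g h] image_comp[of g h R] by metis
  qed
  then show "bij g" "additive g" "g ` R = R" by auto
qed

lemma weyl_group_subgroup:
  assumes "S \<subseteq> R"
  shows "subgroup (weyl_group pair S coroot) (BijGroup UNIV)"
  unfolding weyl_group_def
  by (rule group.generate_is_subgroup[OF group_BijGroup])
    (use assms in \<open>auto simp: BijGroup_UNIV_simps bij_reflection\<close>)

lemma weyl_group_mono:
  assumes "S \<subseteq> R"
  shows "weyl_group pair S coroot \<subseteq> weyl_group pair R coroot"
  unfolding weyl_group_def
  by (rule group.mono_generate[OF group_BijGroup]) (use assms in auto)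

lemma card_weyl_group_dvd:
  assumes "S \<subseteq> R"
  shows "card (weyl_group pair S coroot) dvd card (weyl_group pair R coroot)"
proof -
  interpret W: group "BijGroup UNIV\<lparr>carrier := weyl_group pair R coroot\<rparr>"
    by (rule group.subgroup_imp_group[OF group_BijGroup weyl_group_subgroup]) simp
  have "subgroup (weyl_group pair S coroot) (BijGroup UNIV\<lparr>carrier := weyl_group pair R coroot\<rparr>)"
    using assms
    by (intro group.subgroup_incl[OF group_BijGroup] weyl_group_subgroup weyl_group_mono) simp_all
  from W.lagrange[OF this] dvd_triv_right
  have "card (weyl_group pair S coroot) dvd
      Coset.order (BijGroup UNIV\<lparr>carrier := weyl_group pair R coroot\<rparr>)"
    by (rule subst)
  then show ?thesis
    by (simp add: Coset.order_def)
qed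

lemma ord_dvd_card_weyl_group:
  assumes "w \<in> weyl_group pair R coroot"
  shows "group.ord (BijGroup UNIV) w dvd card (weyl_group pair R coroot)"
proof -
  interpret B: group "BijGroup (UNIV :: 'x set)"
    by (rule group_BijGroup)
  interpret W: group "BijGroup UNIV\<lparr>carrier := weyl_group pair R coroot\<rparr>"
    by (rule B.subgroup_imp_group[OF weyl_group_subgroup]) simp
  have "w [^]\<^bsub>BijGroup UNIV\<^esub> card (weyl_group pair R coroot) = \<one>\<^bsub>BijGroup UNIV\<^esub>"
    using W.pow_order_eq_1[of w] assms
    by (simp add: Coset.order_def B.nat_pow_consistent[symmetric])
  moreover have "w \<in> carrier (BijGroup UNIV)"
    using weyl_group_root_automorphism(1)[OF assms] by (simp add: BijGroup_UNIV_simps)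
  ultimately show ?thesis
    using B.pow_eq_id by blast
qed


section \<open>Rational closedness of the vanishing roots\<close>

text \<open>
  Right translation by the reflection in \<open>\<beta>\<close> permutes the group and changes the sign of \<open>\<beta>\<close>, so the
  sum equals its own negative.
\<close>

lemma sum_weyl_orbit_root:
  assumes S: "S \<subseteq> R" and "\<beta> \<in> S"
  shows "(\<Sum>g\<in>weyl_group pair S coroot. g \<beta>) = 0" (is "?s = 0")
proof -
  let ?W = "weyl_group pair S coroot" and ?t = "reflection pair coroot \<beta>"
  have \<beta>: "\<beta> \<in> R" using assms by auto
  have t: "?t \<in> ?W"
    unfolding weyl_group_def by (rule generate.incl) (use assms in auto)
  have W: "bij g" "additive g" if "g \<in> ?W" for g
    using weyl_group_root_automorphism weyl_group_mono[OF S] that by blast+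
  have closed: "g \<circ> ?t \<in> ?W" if "g \<in> ?W" for g
    using subgroup.m_closed[OF weyl_group_subgroup[OF S] that t] W that bij_reflection[OF \<beta>]
    by (simp add: BijGroup_UNIV_simps)
  have tt: "?t \<circ> ?t = id"
    by (auto simp: reflection_involution[OF \<beta>])
  have "?s = (\<Sum>g\<in>?W. (g \<circ> ?t) \<beta>)"
    by (rule sum.reindex_bij_witness[of _ "\<lambda>g. g \<circ> ?t" "\<lambda>g. g \<circ> ?t"])
      (auto simp: closed comp_assoc tt reflection_involution[OF \<beta>])
  also have "\<dots> = (\<Sum>g\<in>?W. - g \<beta>)"
    by (rule sum.cong) (auto simp: reflection_self[OF \<beta>] additive.minus[OF W(2)])
  also have "\<dots> = - ?s"
    by (rule sum_negf)
  finally have "?s + ?s = 0"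
    by (metis add.right_inverse)
  moreover have "zscale 2 ?s = ?s + ?s"
    using zscale_add[of 1 1 ?s] by (simp add: zscale_def)
  ultimately show ?thesis
    using zscale_eq_0_iff[of 2 ?s] by simp
qed

lemma rat_comb_clear_denominators:
  assumes "finite S" "rat_comb pair S \<alpha>"
  obtains N :: int and n :: "'x \<Rightarrow> int"
  where "N > 0" "zscale N \<alpha> = (\<Sum>\<beta>\<in>S. zscale (n \<beta>) \<beta>)"
proof -
  obtain c :: "'x \<Rightarrow> rat"
    where c: "\<And>y. of_int (pair \<alpha> y) = (\<Sum>\<beta>\<in>S. c \<beta> * of_int (pair \<beta> y))"
    using assms(2) unfolding rat_comb_def by blast
  define d where "d \<beta> = snd (quotient_of (c \<beta>))" for \<beta>
  define N where "N = (\<Prod>\<beta>\<in>S. d \<beta>)"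
  define n where "n \<beta> = fst (quotient_of (c \<beta>)) * (\<Prod>\<gamma>\<in>S - {\<beta>}. d \<gamma>)" for \<beta>
  have d: "d \<beta> > 0" for \<beta>
    unfolding d_def by (rule quotient_of_denom_pos')
  have n: "of_int N * c \<beta> = of_int (n \<beta>)" if "\<beta> \<in> S" for \<beta>
  proof -
    have "c \<beta> = of_int (fst (quotient_of (c \<beta>))) / of_int (d \<beta>)"
      unfolding d_def by (rule quotient_of_div) simp
    moreover have "N = d \<beta> * (\<Prod>\<gamma>\<in>S - {\<beta>}. d \<gamma>)"
      unfolding N_def using assms(1) that by (rule prod.remove)
    ultimately show ?thesis
      using d[of \<beta>] by (simp add: n_def field_simps)
  qed
  have "zscale N \<alpha> = (\<Sum>\<beta>\<in>S. zscale (n \<beta>) \<beta>)"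
  proof (rule pair_ext)
    fix y
    have "(of_int (N * pair \<alpha> y) :: rat) = (\<Sum>\<beta>\<in>S. of_int N * c \<beta> * of_int (pair \<beta> y))"
      by (simp add: c sum_distrib_left mult.assoc)
    also have "\<dots> = of_int (\<Sum>\<beta>\<in>S. n \<beta> * pair \<beta> y)"
      by (simp add: n)
    finally have "N * pair \<alpha> y = (\<Sum>\<beta>\<in>S. n \<beta> * pair \<beta> y)"
      by (simp only: of_int_eq_iff)
    then show "pair (zscale N \<alpha>) y = pair (\<Sum>\<beta>\<in>S. zscale (n \<beta>) \<beta>) y"
      by (simp add: additive.sum[OF additive_pair] pair_zscale)
  qed
  moreover have "N > 0"
    unfolding N_def using d by (simp add: prod_pos)
  ultimately show thesis by (rule that[rotated])
qed

lemma weyl_group_fixes: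
  assumes u: "additive u" and S: "S \<subseteq> R" and vanish: "\<And>\<beta>. \<beta> \<in> S \<Longrightarrow> u \<beta> = 0"
    and "g \<in> weyl_group pair S coroot"
  shows "u (g \<chi>) = u \<chi>"
proof -
  have "bij g \<and> (\<forall>\<chi>. u (g \<chi>) = u \<chi>)"
    using assms(4) S
  proof (induction rule: weyl_group_induct)
    case (reflection \<alpha>)
    then show ?case
      using vanish
      by (simp add: reflection_def additive.diff[OF u] additive_zscale[OF u]) (simp add: zscale_def)
  qed auto
  then show ?thesis by blast
qed

text \<open>
  The order of the group generated by the reflections in \<open>S\<close> replaces the denominators of the
  rational combination, about whose divisibility by the characteristic nothing is known.
\<close>

lemma rat_comb_vanishing:
  fixes u :: "'x \<Rightarrow> 'k::field"
  assumes card: "of_nat (card (weyl_group pair R coroot)) \<noteq> (0::'k)"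
    and u: "additive u" and S: "S \<subseteq> R" and vanish: "\<And>\<beta>. \<beta> \<in> S \<Longrightarrow> u \<beta> = 0"
    and comb: "rat_comb pair S \<alpha>"
  shows "u \<alpha> = 0"
proof -
  let ?W = "weyl_group pair S coroot"
  have W: "additive g" if "g \<in> ?W" for g
    using weyl_group_root_automorphism weyl_group_mono[OF S] that by blast
  obtain N n where N: "N > 0" and rel: "zscale N \<alpha> = (\<Sum>\<beta>\<in>S. zscale (n \<beta>) \<beta>)"
    using rat_comb_clear_denominators comb S finite_R finite_subset by metis
  have add_zscale: "additive (zscale m :: 'x \<Rightarrow> 'x)" for m
    by standard (simp add: zscale_def sum.distrib)
  have "zscale N (\<Sum>g\<in>?W. g \<alpha>) = (\<Sum>g\<in>?W. g (zscale N \<alpha>))"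
    by (simp add: additive.sum[OF add_zscale] additive_zscale[OF W])
  also have "\<dots> = (\<Sum>g\<in>?W. \<Sum>\<beta>\<in>S. zscale (n \<beta>) (g \<beta>))"
    by (simp add: rel additive.sum[OF W] additive_zscale[OF W])
  also have "\<dots> = (\<Sum>\<beta>\<in>S. zscale (n \<beta>) (\<Sum>g\<in>?W. g \<beta>))"
    by (subst sum.swap) (simp add: additive.sum[OF add_zscale])
  also have "\<dots> = 0"
    by (intro sum.neutral) (simp add: sum_weyl_orbit_root[OF S] zscale_eq_0_iff)
  finally have "(\<Sum>g\<in>?W. g \<alpha>) = 0"
    using N by (simp add: zscale_eq_0_iff)
  then have "(\<Sum>g\<in>?W. u (g \<alpha>)) = 0"
    using additive.sum[OF u, of "\<lambda>g. g \<alpha>" ?W] additive.zero[OF u] by simp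
  then have "of_nat (card ?W) * u \<alpha> = 0"
    by (simp add: weyl_group_fixes[OF u S vanish])
  moreover have "of_nat (card ?W) \<noteq> (0::'k)"
    using card_weyl_group_dvd[OF S] card by (metis dvdE mult_zero_left of_nat_mult)
  ultimately show ?thesis by simp
qed

end


section \<open>Coefficients of points of the stratum\<close>

lemma twisted_torus_iff:
  fixes z :: "'k::field"
  shows "u \<in> twisted_torus w z \<longleftrightarrow>
     (\<forall>j. additive (\<lambda>\<chi>. u \<chi> $ j)) \<and> (\<forall>j \<chi>. z ^ j * u (inv' w \<chi>) $ j = u \<chi> $ j)"
proof -
  have "additive u \<longleftrightarrow> (\<forall>j. additive (\<lambda>\<chi>. u \<chi> $ j))"
    unfolding additive_def fps_eq_iff fps_add_nth by blast
  moreover have "wact w (tau_E z \<circ> u) = u \<longleftrightarrow> (\<forall>j \<chi>. z ^ j * u (inv' w \<chi>) $ j = u \<chi> $ j)"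
    unfolding fun_eq_iff fps_eq_iff wact_def tau_E_def o_apply fps_nth_compose_linear by blast
  ultimately show ?thesis
    by (simp add: twisted_torus_def lie_torus_def)
qed

lemma val_E_eq_Fin_iff:
  fixes f :: "'k::field fps"
  assumes "l > 0"
  shows "val_E l f = Fin (of_nat n / of_nat l) \<longleftrightarrow> (\<forall>i<n. f $ i = 0) \<and> f $ n \<noteq> 0"
proof -
  have "val_E l f = Fin (of_nat n / of_nat l) \<longleftrightarrow> f \<noteq> 0 \<and> subdegree f = n"
    using assms by (auto simp: val_E_def)
  also have "\<dots> \<longleftrightarrow> (\<forall>i<n. f $ i = 0) \<and> f $ n \<noteq> 0"
  proof
    assume "f \<noteq> 0 \<and> subdegree f = n"
    then show "(\<forall>i<n. f $ i = 0) \<and> f $ n \<noteq> 0"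
      using nth_less_subdegree_zero[of _ f] nth_subdegree_nonzero[of f] by blast
  next
    assume f: "(\<forall>i<n. f $ i = 0) \<and> f $ n \<noteq> 0"
    then have "subdegree f = n" by (intro subdegreeI) blast+
    moreover have "f \<noteq> 0" using f by auto
    ultimately show "f \<noteq> 0 \<and> subdegree f = n" by blast
  qed
  finally show ?thesis .
qed

lemma val_E_eq_FinE:
  assumes "val_E l f = Fin q"
  obtains n :: nat where "q = of_nat n / of_nat l"
  using assms by (auto simp: val_E_def split: if_splits)

lemma root_level_iff:
  assumes "l > 0" "r \<alpha> = of_nat n / of_nat l"
  shows "\<alpha> \<in> root_level R r l m \<longleftrightarrow> \<alpha> \<in> R \<and> m \<le> n"
  using assms by (simp add: root_level_def divide_le_cancel)


section \<open>Cosets and eigenvectors\<close>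

definition lie_coset where
  "lie_coset R r l j v = {v' \<in> lie_level R r l (Suc j). (\<lambda>\<chi>. v \<chi> - v' \<chi>) \<in> lie_level R r l j}"

lemma lie_quot_eq:
  "lie_quot R r l j = lie_coset R r l j ` lie_level R r l (Suc j)"
  by (auto simp: lie_quot_def quotient_def lie_coset_def)

lemma lie_level_iff:
  "u \<in> lie_level R r l m \<longleftrightarrow> additive u \<and> (\<forall>\<alpha>\<in>root_level R r l m. u \<alpha> = 0)"
  by (auto simp: lie_level_def lie_torus_def differential_def)

lemma additive_diff_fun: "additive f \<Longrightarrow> additive g \<Longrightarrow> additive (\<lambda>\<chi>. f \<chi> - g \<chi>)"
  by (auto simp: additive_def)

lemma additive_cmult: "additive f \<Longrightarrow> additive (\<lambda>\<chi>. (c::'k::field) * f \<chi>)"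
  by (auto simp: additive_def distrib_left)

text \<open>
  Two elements of \<open>\<aa>\<^sub>j\<^sub>+\<^sub>1\<close> are congruent modulo \<open>\<aa>\<^sub>j\<close> exactly if the roots in \<open>R\<^sub>j\<close> do not tell them
  apart.  This turns all questions about cosets into questions about values at roots.
\<close>

lemma lie_coset_iff:
  assumes "v \<in> lie_level R r l (Suc j)"
  shows "v' \<in> lie_coset R r l j v \<longleftrightarrow>
    v' \<in> lie_level R r l (Suc j) \<and> (\<forall>\<alpha>\<in>root_level R r l j. v \<alpha> = v' \<alpha>)"
  using assms by (auto simp: lie_coset_def lie_level_iff intro: additive_diff_fun)

lemma quot_differential_lie_coset:
  assumes "v \<in> lie_level R r l (Suc j)" "\<alpha> \<in> root_level R r l j"
  shows "quot_differential \<alpha> (lie_coset R r l j v) = v \<alpha>"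
proof -
  have "differential \<alpha> ` lie_coset R r l j v = {v \<alpha>}"
    using assms by (force simp: lie_coset_iff differential_def)
  then show ?thesis by (simp add: quot_differential_def)
qed

lemma image_cmult_lie_coset:
  fixes c :: "'k::field"
  assumes v: "v \<in> lie_level R r l (Suc j)" and c: "c \<noteq> 0"
  shows "(\<lambda>u \<chi>. c * u \<chi>) ` lie_coset R r l j v = lie_coset R r l j (\<lambda>\<chi>. c * v \<chi>)"
proof (intro equalityI subsetI)
  have cv: "(\<lambda>\<chi>. c * v \<chi>) \<in> lie_level R r l (Suc j)"
    using v by (auto simp: lie_level_iff additive_cmult)
  {
    fix u assume "u \<in> (\<lambda>u \<chi>. c * u \<chi>) ` lie_coset R r l j v"
    then show "u \<in> lie_coset R r l j (\<lambda>\<chi>. c * v \<chi>)"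
      unfolding lie_coset_iff[OF cv] using v
      by (auto simp: lie_coset_iff lie_level_iff additive_cmult)
  next
    fix u assume u: "u \<in> lie_coset R r l j (\<lambda>\<chi>. c * v \<chi>)"
    then have "v \<alpha> = inverse c * u \<alpha>" if "\<alpha> \<in> root_level R r l j" for \<alpha>
      using that c unfolding lie_coset_iff[OF cv] by (metis field_class.field_inverse mult.assoc mult_1)
    then have "(\<lambda>\<chi>. inverse c * u \<chi>) \<in> lie_coset R r l j v"
      using u unfolding lie_coset_iff[OF cv] lie_coset_iff[OF v]
      by (simp add: lie_level_iff additive_cmult)
    moreover have "u = (\<lambda>\<chi>. c * (inverse c * u \<chi>))"
      using c by (simp flip: mult.assoc)
    ultimately show "u \<in> (\<lambda>u \<chi>. c * u \<chi>) ` lie_coset R r l j v"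
      by (intro image_eqI[where x = "\<lambda>\<chi>. inverse c * u \<chi>"])
  }
qed

lemma image_wact_lie_coset:
  fixes v :: "'x::ab_group_add \<Rightarrow> 'k::field"
  assumes w: "bij w" "additive w" "\<And>m. w ` root_level R r l m = root_level R r l m"
    and v: "v \<in> lie_level R r l (Suc j)"
  shows "wact w ` lie_coset R r l j v = lie_coset R r l j (wact w v)"
proof (intro equalityI subsetI)
  have inv_level: "inv' w \<alpha> \<in> root_level R r l m" if "\<alpha> \<in> root_level R r l m" for m \<alpha>
    using w(1) w(3)[of m] that by (metis bij_inv_eq_iff imageE)
  have w_level: "w \<alpha> \<in> root_level R r l m" if "\<alpha> \<in> root_level R r l m" for m \<alpha>
    using w(3)[of m] that by blast
  have level: "wact w u \<in> lie_level R r l m" if "u \<in> lie_level R r l m" for u :: "'x \<Rightarrow> 'k" and m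
    using that additive_comp[OF _ additive_inv[OF w(2,1)], of u]
    by (auto simp: lie_level_iff wact_def comp_def inv_level)
  {
    fix u assume "u \<in> wact w ` lie_coset R r l j v"
    then show "u \<in> lie_coset R r l j (wact w v)"
      unfolding lie_coset_iff[OF level[OF v]] using v
      by (auto simp: lie_coset_iff level) (auto simp: wact_def inv_level)
  next
    fix u assume u: "u \<in> lie_coset R r l j (wact w v)"
    have "v \<alpha> = u (w \<alpha>)" if "\<alpha> \<in> root_level R r l j" for \<alpha>
      using u w_level[OF that] w(1) unfolding lie_coset_iff[OF level[OF v]]
      by (auto simp: wact_def bij_is_inj)
    moreover have "additive (u \<circ> w)"
      using u w(2) unfolding lie_coset_iff[OF level[OF v]]
      by (simp add: lie_level_iff additive_comp del: comp_apply)
    ultimately have "u \<circ> w \<in> lie_coset R r l j v"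
      using u w_level unfolding lie_coset_iff[OF level[OF v]] lie_coset_iff[OF v]
      by (simp add: lie_level_iff)
    moreover have "u = wact w (u \<circ> w)"
      using w(1) by (auto simp: wact_def bij_is_surj surj_f_inv_f)
    ultimately show "u \<in> wact w ` lie_coset R r l j v"
      by blast
  }
qed

text \<open>
  The witness is \<open>l\<^sup>-\<^sup>1 \<Sum>i<l. z\<^bsup>ij\<^esup> w\<^sup>i v\<close>, the projection of \<open>v\<close> to the eigenspace of \<open>w\<close> for \<open>z\<^bsup>-j\<^esup>\<close>.
  Since \<open>S\<close> is stable under \<open>w\<^sup>-\<^sup>1\<close>, the eigenvector equation for \<open>v\<close> on \<open>S\<close> can be iterated there, so
  every summand agrees with \<open>v\<close> on \<open>S\<close>.
\<close>

lemma eigen_lift: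
  fixes v :: "'x::ab_group_add \<Rightarrow> 'k::field" and z :: 'k
  assumes w: "bij w" "additive w" "w ^^ l = id" and z: "z ^ l = 1" and l: "of_nat l \<noteq> (0::'k)"
    and S: "\<And>\<alpha>. \<alpha> \<in> S \<Longrightarrow> inv' w \<alpha> \<in> S"
    and v: "additive v" "\<And>\<alpha>. \<alpha> \<in> S \<Longrightarrow> z ^ j * v (inv' w \<alpha>) = v \<alpha>"
  obtains u where "additive u" "\<And>\<chi>. z ^ j * u (inv' w \<chi>) = u \<chi>" "\<And>\<alpha>. \<alpha> \<in> S \<Longrightarrow> u \<alpha> = v \<alpha>"
proof
  define f where "f i \<chi> = z ^ (i * j) * v ((inv' w ^^ i) \<chi>)" for i \<chi>
  have f_Suc: "f (Suc i) \<chi> = z ^ j * f i (inv' w \<chi>)" for i \<chi>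
    unfolding f_def funpow_Suc_right o_apply by (simp add: power_add mult.assoc)
  define u where "u \<chi> = inverse (of_nat l) * (\<Sum>i<l. f i \<chi>)" for \<chi>
  have add_pow: "additive (inv' w ^^ i)" for i
  proof (induction i)
    case (Suc i)
    then show ?case
      using additive_comp[OF additive_inv[OF w(2,1)] Suc] by (simp only: funpow.simps)
  qed (simp add: additive_def)
  show "additive u"
    unfolding additive_def u_def f_def
    by (simp add: additive.add[OF add_pow] additive.add[OF v(1)] distrib_left sum.distrib)
  show "z ^ j * u (inv' w \<chi>) = u \<chi>" for \<chi>
  proof -
    have "inv' w ^^ l = id"
      using inv_fn[OF w(1), of l] w(3) inv_id by simp
    then have cyc: "f l \<chi> = f 0 \<chi>"
      using z by (simp add: f_def power_mult)
    have "z ^ j * u (inv' w \<chi>) = inverse (of_nat l) * (\<Sum>i<l. z ^ j * f i (inv' w \<chi>))"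
      unfolding u_def sum_distrib_left[symmetric] by (rule mult.left_commute)
    also have "(\<Sum>i<l. z ^ j * f i (inv' w \<chi>)) = (\<Sum>i<l. f (Suc i) \<chi>)"
      by (simp only: f_Suc)
    also have "(\<Sum>i<l. f (Suc i) \<chi>) = (\<Sum>i<l. f i \<chi>)"
      using sum.lessThan_Suc_shift[of "\<lambda>i. f i \<chi>" l] cyc by (simp add: add.commute)
    finally show ?thesis
      by (simp add: u_def)
  qed
  show "u \<alpha> = v \<alpha>" if "\<alpha> \<in> S" for \<alpha>
  proof -
    have "f i \<alpha> = v \<alpha>" if "\<alpha> \<in> S" for i \<alpha>
      using that
    proof (induction i arbitrary: \<alpha>)
      case (Suc i)
      have "f (Suc i) \<alpha> = z ^ j * f i (inv' w \<alpha>)"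
        by (rule f_Suc)
      also have "\<dots> = v \<alpha>"
        using Suc S v(2) by simp
      finally show ?case .
    qed (simp add: f_def)
    then show ?thesis
      using l that by (simp add: u_def)
  qed
qed


section \<open>The criterion for non-emptiness\<close>

context root_datum
begin

lemma weyl_group_root_level:
  assumes w: "w \<in> weyl_group pair R coroot" and r: "\<And>\<alpha>. \<alpha> \<in> R \<Longrightarrow> r (inv' w \<alpha>) = r \<alpha>"
  shows "w ` root_level R r l m = root_level R r l m"
proof -
  note W = weyl_group_root_automorphism[OF w]
  have inv: "inv' w (w \<alpha>) = \<alpha>" "w (inv' w \<alpha>) = \<alpha>" for \<alpha>
    using W(1) by (simp_all add: bij_is_inj bij_is_surj surj_f_inv_f)
  have "w \<alpha> \<in> R" "inv' w \<alpha> \<in> R" if "\<alpha> \<in> R" for \<alpha>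
    using W(3) that inv by (blast, metis imageE)
  then show ?thesis
    unfolding root_level_def using r inv
    by (auto simp: image_iff) (metis, metis)
qed

text \<open>
  Here and below \<open>z\<close> plays the role of \<open>\<zeta>\<^sub>l\<close>.  Each condition is read off the coefficients \<open>c j\<close>
  of \<open>u\<close>: with \<open>r(\<alpha>) = n(\<alpha>)/l\<close>, the number \<open>n(\<alpha>)\<close> is the first index \<open>j\<close> for which \<open>c j\<close> does not
  vanish at \<open>\<alpha>\<close>, so \<open>R\<^sub>m\<close> consists of the roots at which \<open>c 0, \<dots>, c (m - 1)\<close> vanish.
\<close>

lemma stratum_nonempty_imp:
  fixes z :: "'k::field"
  assumes card: "of_nat (card (weyl_group pair R coroot)) \<noteq> (0::'k)"
    and w: "w \<in> weyl_group pair R coroot" and l: "l > 0" and z: "z \<noteq> 0"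
    and u: "u \<in> stratum R l w z r"
  shows "\<forall>\<alpha>\<in>R. \<exists>n::int. r \<alpha> = of_int n / of_nat l"
    and "Q_closed pair R (root_level R r l m)"
    and "\<forall>\<alpha>\<in>R. wact w r \<alpha> = r \<alpha>"
    and "lie_quot_eigen R l w z r j \<inter> lie_quot_sharp R l r j \<noteq> {}"
proof -
  note W = weyl_group_root_automorphism[OF w]
  have inv_R: "inv' w \<alpha> \<in> R" if "\<alpha> \<in> R" for \<alpha>
    using W(1,3) that by (metis bij_inv_eq_iff imageE)
  define c where "c j \<chi> = u \<chi> $ j" for j \<chi>
  have add: "additive (c j)" and eig: "z ^ j * c j (inv' w \<chi>) = c j \<chi>" for j \<chi>
    using u by (auto simp: stratum_def twisted_torus_iff c_def[abs_def])
  have "\<exists>n. r \<alpha> = of_nat n / of_nat l" if "\<alpha> \<in> R" for \<alpha>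
    using u that by (auto simp: stratum_def elim!: val_E_eq_FinE)
  then obtain n where n: "\<And>\<alpha>. \<alpha> \<in> R \<Longrightarrow> r \<alpha> = of_nat (n \<alpha>) / of_nat l"
    by metis
  have n_iff: "n \<alpha> = k \<longleftrightarrow> (\<forall>i<k. c i \<alpha> = 0) \<and> c k \<alpha> \<noteq> 0" if "\<alpha> \<in> R" for \<alpha> k
  proof -
    have "n \<alpha> = k \<longleftrightarrow> val_E l (u \<alpha>) = Fin (of_nat k / of_nat l)"
      using u that n l by (auto simp: stratum_def differential_def)
    then show ?thesis
      using val_E_eq_Fin_iff[OF l, of "u \<alpha>" k] by (simp add: c_def)
  qed
  have level: "\<alpha> \<in> root_level R r l m \<longleftrightarrow> \<alpha> \<in> R \<and> m \<le> n \<alpha>" for \<alpha> m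
    using root_level_iff[OF l, of r \<alpha> "n \<alpha>" R m] n by (auto simp: root_level_def)
  have le_n_iff: "m \<le> n \<alpha> \<longleftrightarrow> (\<forall>i<m. c i \<alpha> = 0)" if "\<alpha> \<in> R" for \<alpha> m
    using n_iff[OF that, of "n \<alpha>"] by (meson le_less_linear less_le_trans)

  show "\<forall>\<alpha>\<in>R. \<exists>n::int. r \<alpha> = of_int n / of_nat l"
    using n by (metis of_int_of_nat_eq)

  show "Q_closed pair R (root_level R r l m)"
    unfolding Q_closed_def
  proof (intro conjI ballI impI)
    fix \<alpha> assume \<alpha>: "\<alpha> \<in> R" "rat_comb pair (root_level R r l m) \<alpha>"
    have "c i \<alpha> = 0" if "i < m" for i
    proof (rule rat_comb_vanishing[OF card add _ _ \<alpha>(2)])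
      show "c i \<beta> = 0" if "\<beta> \<in> root_level R r l m" for \<beta>
        using that \<open>i < m\<close> level le_n_iff by blast
    qed (auto simp: root_level_def)
    then show "\<alpha> \<in> root_level R r l m"
      using \<alpha> level le_n_iff by blast
  qed (auto simp: root_level_def)

  have rw: "r (inv' w \<alpha>) = r \<alpha>" if "\<alpha> \<in> R" for \<alpha>
  proof -
    have "c i (inv' w \<alpha>) = 0 \<longleftrightarrow> c i \<alpha> = 0" for i
      using eig[of i \<alpha>] z by (metis mult_eq_0_iff power_not_zero)
    then have "n (inv' w \<alpha>) = n \<alpha>"
      using n_iff that inv_R by metis
    then show ?thesis
      using n that inv_R by simp
  qed
  then show "\<forall>\<alpha>\<in>R. wact w r \<alpha> = r \<alpha>"
    by (simp add: wact_def)

  have cj: "c j \<in> lie_level R r l (Suc j)"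
    using add level le_n_iff by (auto simp: lie_level_iff)
  have "wact w (c j) = (\<lambda>\<chi>. inverse z ^ j * c j \<chi>)"
  proof
    fix \<chi>
    show "wact w (c j) \<chi> = inverse z ^ j * c j \<chi>"
      using eig[of j \<chi>] z by (simp add: wact_def field_simps)
  qed
  then have "lie_coset R r l j (c j) \<in> lie_quot_eigen R l w z r j"
    using cj z
    by (auto simp: lie_quot_eigen_def lie_quot_eq image_cmult_lie_coset
        image_wact_lie_coset[OF W(1,2) weyl_group_root_level[of w r, OF w rw] cj])
  moreover have "lie_coset R r l j (c j) \<in> lie_quot_sharp R l r j"
  proof -
    have "c j \<alpha> \<noteq> 0" if "\<alpha> \<in> root_level R r l j - root_level R r l (Suc j)" for \<alpha>
      using that level n_iff[of \<alpha> j] by auto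
    then show ?thesis
      using cj by (auto simp: lie_quot_sharp_def lie_quot_eq quot_differential_lie_coset)
  qed
  ultimately show "lie_quot_eigen R l w z r j \<inter> lie_quot_sharp R l r j \<noteq> {}"
    by blast
qed

text \<open>
  A representative \<open>v\<close> of the given coset is an eigenvector only modulo \<open>\<aa>\<^sub>j\<close>, that is, at the roots
  in \<open>R\<^sub>j\<close>.  Its projection to the eigenspace keeps the values at these roots, which are the only
  ones that membership in \<open>\<aa>\<^sub>j\<^sub>+\<^sub>1\<close> and regularity depend on.
\<close>

lemma coefficient_of_eigen_sharp:
  fixes z :: "'k::field"
  assumes w: "w \<in> weyl_group pair R coroot" "w ^^ l = id" and z: "z ^ l = 1"
    and l: "of_nat l \<noteq> (0::'k)"
    and rw: "\<And>\<alpha>. \<alpha> \<in> R \<Longrightarrow> r (inv' w \<alpha>) = r \<alpha>"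
    and ne: "lie_quot_eigen R l w z r j \<inter> lie_quot_sharp R l r j \<noteq> {}"
  obtains c where "additive c" "\<And>\<chi>. z ^ j * c (inv' w \<chi>) = c \<chi>"
    "\<And>\<alpha>. \<alpha> \<in> root_level R r l (Suc j) \<Longrightarrow> c \<alpha> = 0"
    "\<And>\<alpha>. \<alpha> \<in> root_level R r l j - root_level R r l (Suc j) \<Longrightarrow> c \<alpha> \<noteq> 0"
proof -
  note W = weyl_group_root_automorphism[OF w(1)]
  have "z \<noteq> 0"
    using z l by (metis of_nat_0 power_0_left zero_neq_one)
  obtain v where v: "v \<in> lie_level R r l (Suc j)"
    and eigen: "lie_coset R r l j v \<in> lie_quot_eigen R l w z r j"
    and sharp: "lie_coset R r l j v \<in> lie_quot_sharp R l r j"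
    using ne by (auto simp: lie_quot_eigen_def lie_quot_eq)
  have "v \<in> lie_coset R r l j v"
    using v by (simp add: lie_coset_iff)
  then have "wact w v \<in> (\<lambda>u \<chi>. inverse z ^ j * u \<chi>) ` lie_coset R r l j v"
    using eigen by (auto simp: lie_quot_eigen_def)
  then obtain v' where v': "v' \<in> lie_coset R r l j v" "wact w v = (\<lambda>\<chi>. inverse z ^ j * v' \<chi>)"
    by blast
  have "z ^ j * v (inv' w \<alpha>) = v \<alpha>" if "\<alpha> \<in> root_level R r l j" for \<alpha>
  proof -
    have "v (inv' w \<alpha>) = inverse z ^ j * v \<alpha>"
      using v' that v by (auto simp: lie_coset_iff wact_def fun_eq_iff)
    then show ?thesis
      using \<open>z \<noteq> 0\<close> by (simp add: field_simps)
  qed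
  moreover have "inv' w \<alpha> \<in> root_level R r l j" if "\<alpha> \<in> root_level R r l j" for \<alpha>
    using weyl_group_root_level[of w r l j] w(1) rw W(1) that by (metis bij_inv_eq_iff imageE)
  moreover have "additive v"
    using v by (simp add: lie_level_iff)
  ultimately obtain c where c: "additive c" "\<And>\<chi>. z ^ j * c (inv' w \<chi>) = c \<chi>"
      "\<And>\<alpha>. \<alpha> \<in> root_level R r l j \<Longrightarrow> c \<alpha> = v \<alpha>"
    using eigen_lift[OF W(1,2) w(2) z l, of "root_level R r l j" v j] by metis
  show thesis
  proof (rule that)
    show "c \<alpha> = 0" if "\<alpha> \<in> root_level R r l (Suc j)" for \<alpha>
    proof -
      have "(of_nat j :: rat) / of_nat l \<le> of_nat (Suc j) / of_nat l"
        by (rule divide_right_mono) auto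
      then have "\<alpha> \<in> root_level R r l j"
        using that by (auto simp: root_level_def)
      then show ?thesis
        using c(3) v that by (simp add: lie_level_iff)
    qed
    show "c \<alpha> \<noteq> 0" if "\<alpha> \<in> root_level R r l j - root_level R r l (Suc j)" for \<alpha>
      using that c(3) sharp v by (auto simp: lie_quot_sharp_def quot_differential_lie_coset)
  qed (use c in auto)
qed

lemma stratum_nonempty_if:
  fixes z :: "'k::field"
  assumes w: "w \<in> weyl_group pair R coroot" "w ^^ l = id" and z: "z ^ l = 1"
    and l: "of_nat l \<noteq> (0::'k)"
    and pos: "\<forall>\<alpha>\<in>R. 0 \<le> r \<alpha>"
    and int: "\<forall>\<alpha>\<in>R. \<exists>n::int. r \<alpha> = of_int n / of_nat l"
    and rw: "\<forall>\<alpha>\<in>R. wact w r \<alpha> = r \<alpha>"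
    and ne: "\<And>j. lie_quot_eigen R l w z r j \<inter> lie_quot_sharp R l r j \<noteq> {}"
  shows "stratum R l w z r \<noteq> {}"
proof -
  have l0: "l > 0"
    using l by (cases l) auto
  have rw': "r (inv' w \<alpha>) = r \<alpha>" if "\<alpha> \<in> R" for \<alpha>
    using rw that by (simp add: wact_def)
  define P where "P j c \<longleftrightarrow> additive c \<and> (\<forall>\<chi>. z ^ j * c (inv' w \<chi>) = c \<chi>) \<and>
      (\<forall>\<alpha>\<in>root_level R r l (Suc j). c \<alpha> = 0) \<and>
      (\<forall>\<alpha>\<in>root_level R r l j - root_level R r l (Suc j). c \<alpha> \<noteq> 0)" for j c
  have "\<exists>c. P j c" for j
  proof (rule coefficient_of_eigen_sharp[OF w z l rw' ne[of j]])
    fix c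
    assume "additive c" "\<And>\<chi>. z ^ j * c (inv' w \<chi>) = c \<chi>"
      "\<And>\<alpha>. \<alpha> \<in> root_level R r l (Suc j) \<Longrightarrow> c \<alpha> = 0"
      "\<And>\<alpha>. \<alpha> \<in> root_level R r l j - root_level R r l (Suc j) \<Longrightarrow> c \<alpha> \<noteq> 0"
    then have "P j c"
      unfolding P_def by blast
    then show ?thesis by blast
  qed
  then obtain c where P: "\<And>j. P j (c j)"
    by metis
  have c: "additive (c j)" "z ^ j * c j (inv' w \<chi>) = c j \<chi>"
    "\<alpha> \<in> root_level R r l (Suc j) \<Longrightarrow> c j \<alpha> = 0"
    "\<alpha> \<in> root_level R r l j - root_level R r l (Suc j) \<Longrightarrow> c j \<alpha> \<noteq> 0" for j \<alpha> \<chi>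
    using P[of j] unfolding P_def by blast+
  define u where "u \<chi> = Abs_fps (\<lambda>j. c j \<chi>)" for \<chi>
  have "u \<in> twisted_torus w z"
    by (simp add: twisted_torus_iff u_def c)
  moreover have "val_E l (differential \<alpha> u) = Fin (r \<alpha>)" if \<alpha>: "\<alpha> \<in> R" for \<alpha>
  proof -
    obtain k :: int where k: "r \<alpha> = of_int k / of_nat l"
      using int \<alpha> by blast
    then have "k \<ge> 0"
      using pos \<alpha> l0 by (auto simp: zero_le_divide_iff)
    then have r: "r \<alpha> = of_nat (nat k) / of_nat l"
      using k by simp
    have level: "\<alpha> \<in> root_level R r l m \<longleftrightarrow> m \<le> nat k" for m
      using root_level_iff[of l r \<alpha> "nat k" R m] l0 r \<alpha> by simp
    show ?thesis
      unfolding r val_E_eq_Fin_iff[OF l0]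
      using c(3)[of \<alpha>] c(4)[of \<alpha> "nat k"] level by (auto simp: differential_def u_def)
  qed
  ultimately show ?thesis
    by (auto simp: stratum_def)
qed

end

theorem proposition4p8p2:
  fixes pair :: "'x::ab_group_add \<Rightarrow> 'y::ab_group_add \<Rightarrow> int"
    and R :: "'x set"
    and coroot :: "'x \<Rightarrow> 'y"
    and \<zeta> :: "nat \<Rightarrow> 'k::alg_closed_field"
    and w :: "'x \<Rightarrow> 'x"
    and l :: nat
    and r :: "'x \<Rightarrow> rat"
  assumes "root_datum pair R coroot"
    and "of_nat (card (weyl_group pair R coroot)) \<noteq> (0::'k)"
    and "compatible_roots_unity \<zeta>"
    and "w \<in> weyl_group pair R coroot"
    and "group.ord (BijGroup UNIV) w = l"
    and "\<forall>\<alpha>\<in>R. 0 \<le> r \<alpha>"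
  shows "stratum R l w (\<zeta> l) r \<noteq> {} \<longleftrightarrow>
           (\<forall>\<alpha>\<in>R. \<exists>n::int. r \<alpha> = of_int n / of_nat l) \<and>
           (\<forall>m. Q_closed pair R (root_level R r l m)) \<and>
           (\<forall>\<alpha>\<in>R. wact w r \<alpha> = r \<alpha>) \<and>
           (\<forall>j. lie_quot_eigen R l w (\<zeta> l) r j \<inter> lie_quot_sharp R l r j \<noteq> {})"
proof -
  interpret root_datum pair R coroot by fact
  interpret B: group "BijGroup (UNIV :: 'x set)"
    by (rule group_BijGroup)
  let ?W = "weyl_group pair R coroot"
  have "l dvd card ?W"
    using ord_dvd_card_weyl_group assms(4,5) by blast
  then have l: "of_nat l \<noteq> (0::'k)"
    using assms(2) by (metis dvdE mult_zero_left of_nat_mult)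
  then have l0: "l > 0"
    by (cases l) auto
  have z: "\<zeta> l ^ l = 1"
    using assms(3) l l0 by (auto simp: compatible_roots_unity_def primitive_root_unity_def)
  then have z0: "\<zeta> l \<noteq> 0"
    using l0 by (auto simp: power_0_left)
  have "bij w"
    using weyl_group_root_automorphism(1) assms(4) by blast
  then have wl: "w ^^ l = id"
    using B.pow_ord_eq_1[of w] assms(5) by (simp add: BijGroup_UNIV_simps BijGroup_UNIV_pow)
  show ?thesis
  proof (intro iffI conjI allI)
    assume "stratum R l w (\<zeta> l) r \<noteq> {}"
    then obtain u where u: "u \<in> stratum R l w (\<zeta> l) r"
      by blast
    note * = stratum_nonempty_imp[OF assms(2,4) l0 z0 u]
    show "\<forall>\<alpha>\<in>R. \<exists>n::int. r \<alpha> = of_int n / of_nat l" by (fact *(1))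
    show "Q_closed pair R (root_level R r l m)" for m by (fact *(2))
    show "\<forall>\<alpha>\<in>R. wact w r \<alpha> = r \<alpha>" by (fact *(3))
    show "lie_quot_eigen R l w (\<zeta> l) r j \<inter> lie_quot_sharp R l r j \<noteq> {}" for j by (fact *(4))
  next
    assume "(\<forall>\<alpha>\<in>R. \<exists>n::int. r \<alpha> = of_int n / of_nat l) \<and>
           (\<forall>m. Q_closed pair R (root_level R r l m)) \<and>
           (\<forall>\<alpha>\<in>R. wact w r \<alpha> = r \<alpha>) \<and>
           (\<forall>j. lie_quot_eigen R l w (\<zeta> l) r j \<inter> lie_quot_sharp R l r j \<noteq> {})"
    then show "stratum R l w (\<zeta> l) r \<noteq> {}"
      by (intro stratum_nonempty_if[OF assms(4) wl z l assms(6)]) auto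
  qed
qed

end
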